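(* For every $\varepsilon>0$ there exist constants $c>0$ and $p>0$, depending only on $\varepsilon$, such that the following holds. Let $T\ge100$ be an integer, let $\mathcal{X}=\{0,1,2,\dots,T\}$, let $\mathcal{H}$ be the class of point functions over $\mathcal{X}$, and let $\delta=\frac{1}{20\log_2 T}$. Then for every $(\varepsilon,\delta)$-differentially private online learner $\mathcal{A}$ for $\mathcal{H}$ that answers $T$ queries, there exists a sequence of labeled queries $(x_1,y_1),\dots,(x_T,y_T)\in\mathcal{X}\times\{0,1\}$, consistent with some $h\in\mathcal{H}$ (i.e. $h(x_i)=y_i$ for all $i$), on which $\mathcal{A}$ makes at least $c\log_2 T$ mistakes with probability at least $p$.
   Context: Point functions over $\mathcal{X}$: the class $\{c_x : x\in\mathcal{X}\}$, where $c_x:\mathcal{X}\to\{0,1\}$ satisfies $c_x(y)=1$ if and only if $y=x$. Private online learning model: a $T$-round game between an adversary and a randomized learner $\mathcal{A}$. In round $i$, the adversary chooses a query $x_i\in\mathcal{X}$ and simultaneously the learner chooses a hypothesis $h_i:\mathcal{X}\to\{0,1\}$ (arbitrary, not necessarily in $\mathcal{H}$); thus $h_i$ depends only on the labeled examples $(x_1,y_1),\dots,(x_{i-1},y_{i-1})$ of previous rounds and on the learner's internal randomness. Then the learner sees $x_i$ and the adversary sees $h_i$; the adversary chooses a label $y_i\in\{0,1\}$ such that some $h\in\mathcal{H}$ satisfies $h(x_j)=y_j$ for all $j\le i$, and $y_i$ is given to the learner. A mistake happens in round $i$ if $h_i(x_i)\ne y_i$. Differential privacy: the learner is $(\varepsilon,\delta)$-differentially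 private if for any two sequences of labeled examples in $(\mathcal{X}\times\{0,1\})^T$ that differ in at most one labeled example, with $(h_1,\dots,h_T)$ and $(h_1',\dots,h_T')$ the vectors of all released hypotheses on the two sequences, $\Pr[(h_1,\dots,h_T)\in F]\le e^{\varepsilon}\Pr[(h_1',\dots,h_T')\in F]+\delta$ for every set $F$ of hypothesis vectors. *)

theory Defs
  imports "HOL-Probability.Probability"
begin

type_synonym 'x example = "'x \<times> bool"
type_synonym 'x hypothesis = "'x \<Rightarrow> bool"

text \<open>
  A deterministic online learner maps the labeled examples of all previous rounds to the
  hypothesis of the current round. Labels 1 and 0 are \<^const>\<open>True\<close> and \<^const>\<open>False\<close>.
\<close>

type_synonym 'x det_learner = "'x example list \<Rightarrow> 'x hypothesis"

definition point_function :: "'x set \<Rightarrow> 'x \<Rightarrow> 'x hypothesis" where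
  "point_function X x = (\<lambda>y\<in>X. y = x)"

definition point_functions :: "'x set \<Rightarrow> 'x hypothesis set" where
  "point_functions X = point_function X ` X"

definition example_seqs :: "'x set \<Rightarrow> nat \<Rightarrow> 'x example list set" where
  "example_seqs X T = {S. length S = T \<and> set S \<subseteq> X \<times> UNIV}"

definition consistent :: "'x hypothesis \<Rightarrow> 'x example list \<Rightarrow> bool" where
  "consistent h S \<longleftrightarrow> (\<forall>i<length S. h (fst (S ! i)) = snd (S ! i))"

text \<open>
  A randomized learner is a probability measure \<open>M\<close> on deterministic learners: drawing the
  internal randomness up front fixes the response to every history. Such an \<open>M\<close> arises from
  any probability space of random seeds as the image measure, so no restriction is placed on
  the source of randomness. The sigma-algebra only has to make every prediction on \<open>X\<close> an event.
\<close>

definition online_learner :: "'x set \<Rightarrow> 'x det_learner measure \<Rightarrow> bool" where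
  "online_learner X M \<longleftrightarrow>
     prob_space M \<and>
     (\<forall>H. set H \<subseteq> X \<times> UNIV \<longrightarrow> (\<forall>x\<in>X. {A \<in> space M. A H x} \<in> sets M))"

text \<open>
  The released vector \<open>(h\<^sub>1, \<dots>, h\<^sub>T)\<close> on \<open>S\<close>. Hypotheses are functions on \<open>X\<close> only, so values
  outside of \<open>X\<close> are discarded and cannot be observed in the privacy condition.
\<close>

definition released :: "'x set \<Rightarrow> 'x det_learner \<Rightarrow> 'x example list \<Rightarrow> 'x hypothesis list" where
  "released X A S = map (\<lambda>i. restrict (A (take i S)) X) [0..<length S]"

definition differ_in_at_most_one :: "'a list \<Rightarrow> 'a list \<Rightarrow> bool" where
  "differ_in_at_most_one S S' \<longleftrightarrow>
     length S = length S' \<and> card {i. i < length S \<and> S ! i \<noteq> S' ! i} \<le> 1"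

definition differentially_private ::
    "'x set \<Rightarrow> nat \<Rightarrow> real \<Rightarrow> real \<Rightarrow> 'x det_learner measure \<Rightarrow> bool" where
  "differentially_private X T \<epsilon> \<delta> M \<longleftrightarrow>
     (\<forall>S\<in>example_seqs X T. \<forall>S'\<in>example_seqs X T. differ_in_at_most_one S S' \<longrightarrow>
       (\<forall>F. measure M {A \<in> space M. released X A S \<in> F}
              \<le> exp \<epsilon> * measure M {A \<in> space M. released X A S' \<in> F} + \<delta>))"

definition mistakes :: "'x set \<Rightarrow> 'x det_learner \<Rightarrow> 'x example list \<Rightarrow> nat" where
  "mistakes X A S = card {i. i < length S \<and> (released X A S ! i) (fst (S ! i)) \<noteq> snd (S ! i)}"

end

theory Submission imports Defs begin

text \<open>
  Say that the learner hits in round \<open>t\<close> if its hypothesis of that round is 1 at a target point \<open>x\<close>.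
  The base sequence has only negative labels, and its queries are chosen greedily among the
  unused points so as to maximise the probability of a mistake. Since there are \<open>T + 1\<close> points, one
  point \<open>x\<close> is left over, and it is hit in each round with at most the probability of a mistake.
  So if the base sequence rarely causes \<open>k\<close> mistakes, \<open>x\<close> is hit in at most about \<open>k\<close> rounds on
  average, and some long block of rounds contains a hit with small probability.

  Now replace the first example of the current block by \<open>(x, 1)\<close>, pass to one of its sub-blocks and
  repeat. Each replacement changes one example, so the probability that the first hit lies
  in the block grows to at most \<open>exp \<epsilon> \<cdot> q + \<delta>\<close>. As the first hit lies in only one of the
  sub-blocks, a suitable sub-block regains a factor of \<open>2 exp \<epsilon>\<close>. Hence these probabilities
  have sum at most \<open>2 (exp \<epsilon> \<cdot> q + k \<delta>) < 1\<close> over all \<open>k\<close> levels, and with constant probability all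
  \<open>k = \<Theta>(log T)\<close> planted examples are mistakes.
\<close>

section \<open>Counting, measurability and averaging\<close>

text \<open>On \<open>R\<close> the number of smaller elements of \<open>R\<close> is a strictly
  increasing rank, so at most \<open>m\<close> elements have rank below \<open>m\<close>.\<close>

lemma card_first_elements_le:
  fixes R :: "nat set"
  shows "card {t. t < n \<and> t \<in> R \<and> card (R \<inter> {..<t}) < m} \<le> m"
proof -
  let ?f = "\<lambda>t. card (R \<inter> {..<t})"
  let ?E = "{t. t < n \<and> t \<in> R \<and> ?f t < m}"
  have less: "?f s < ?f t" if "s \<in> R" "s < t" for s t
    using that by (intro psubset_card_mono) auto
  have "inj_on ?f ?E"
  proof (rule inj_onI)
    fix s t assume "s \<in> ?E" "t \<in> ?E" "?f s = ?f t"
    then show "s = t" using less[of s t] less[of t s] by (cases s t rule: linorder_cases) auto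
  qed
  then have "card ?E \<le> card {..<m}" by (rule card_inj_on_le) auto
  then show ?thesis by simp
qed

text \<open>For a learner only single predictions are known to be events. A random subset of a
  finite \<open>N\<close> takes finitely many values, each on an event, so \<open>Q\<close> may be
  arbitrary.\<close>

lemma sets_Collect_index_set:
  assumes "finite N" and "\<And>t. t \<in> N \<Longrightarrow> {A \<in> space M. P t A} \<in> sets M"
  shows "{A \<in> space M. Q {t \<in> N. P t A}} \<in> sets M"
proof -
  have "{A \<in> space M. {t \<in> N. P t A} = J} \<in> sets M" if "J \<subseteq> N" for J
  proof -
    have "{A \<in> space M. {t \<in> N. P t A} = J} = {A \<in> space M. \<forall>t\<in>N. P t A = (t \<in> J)}"
      using that by auto
    also have "\<dots> \<in> sets M"
    proof (intro sets.sets_Collect_finite_All assms)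
      fix t assume "t \<in> N"
      then show "{A \<in> space M. P t A = (t \<in> J)} \<in> sets M"
        using assms(2)[of t] sets.sets_Collect_neg[of M "P t"] by (cases "t \<in> J") auto
    qed
    finally show ?thesis .
  qed
  then have "(\<Union>J\<in>{J \<in> Pow N. Q J}. {A \<in> space M. {t \<in> N. P t A} = J}) \<in> sets M"
    using assms(1) by (intro sets.finite_UN) auto
  also have "(\<Union>J\<in>{J \<in> Pow N. Q J}. {A \<in> space M. {t \<in> N. P t A} = J}) =
      {A \<in> space M. Q {t \<in> N. P t A}}"
    by auto
  finally show ?thesis .
qed

text \<open>Linearity of expectation: the sum is the expected size of a set that
  \<open>card_first_elements_le\<close> bounds pointwise.\<close>

lemma (in prob_space) sum_prob_first_elements_le:
  fixes R :: "'a \<Rightarrow> nat set"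
  assumes "\<And>t. t < n \<Longrightarrow> {A \<in> space M. t \<in> R A \<and> card (R A \<inter> {..<t}) < m} \<in> events"
  shows "(\<Sum>t<n. prob {A \<in> space M. t \<in> R A \<and> card (R A \<inter> {..<t}) < m}) \<le> real m"
proof -
  let ?E = "\<lambda>t. {A \<in> space M. t \<in> R A \<and> card (R A \<inter> {..<t}) < m}"
  have int: "integrable M (indicat_real (?E t))" if "t < n" for t
    using assms[OF that] by (simp add: integrable_indicator_iff emeasure_eq_measure)
  have "(\<Sum>t<n. prob (?E t)) = (\<Sum>t<n. expectation (indicator (?E t)))"
    using assms by (intro sum.cong) auto
  also have "\<dots> = expectation (\<lambda>A. \<Sum>t<n. indicator (?E t) A)"
    using int by (subst Bochner_Integration.integral_sum) auto
  also have "\<dots> \<le> expectation (\<lambda>_. real m)"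
  proof (rule integral_mono)
    fix A assume A: "A \<in> space M"
    have "(\<Sum>t<n. indicat_real (?E t) A) = card {t \<in> {..<n}. A \<in> ?E t}"
      by (simp add: indicator_def sum.If_cases Int_def)
    also have "{t \<in> {..<n}. A \<in> ?E t} = {t. t < n \<and> t \<in> R A \<and> card (R A \<inter> {..<t}) < m}"
      using A by auto
    finally show "(\<Sum>t<n. indicat_real (?E t) A) \<le> real m"
      using card_first_elements_le[of n "R A" m] by simp
  qed (use int in auto)
  finally show ?thesis by (simp add: prob_space)
qed

lemma sum_lessThan_mult:
  fixes f :: "nat \<Rightarrow> 'a::comm_monoid_add"
  shows "(\<Sum>b<m. \<Sum>t\<in>{b * L..<Suc b * L}. f t) = (\<Sum>t<m * L. f t)"
  using sum.nat_group[of f L m] by (simp add: add.commute)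

lemma exists_le_average:
  fixes f :: "'b \<Rightarrow> real"
  assumes "finite B" "B \<noteq> {}"
  obtains b where "b \<in> B" "f b \<le> sum f B / card B"
proof -
  have "\<exists>b\<in>B. f b \<le> sum f B / card B"
  proof (rule ccontr)
    assume "\<not> ?thesis"
    then have "(\<Sum>b\<in>B. sum f B / card B) < sum f B"
      using assms by (intro sum_strict_mono) auto
    then show False using assms by simp
  qed
  then show thesis using that by blast
qed

lemma exists_greedy_distinct_list:
  fixes f :: "'x list \<Rightarrow> 'x \<Rightarrow> real"
  assumes "finite X" "n \<le> card X"
  shows "\<exists>xs. length xs = n \<and> distinct xs \<and> set xs \<subseteq> X \<and>
    (\<forall>t<n. \<forall>x\<in>X - set xs. f (take t xs) x \<le> f (take t xs) (xs ! t))"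
  using assms(2)
proof (induction n)
  case (Suc n)
  then obtain xs where xs: "length xs = n" "distinct xs" "set xs \<subseteq> X"
    "\<forall>t<n. \<forall>x\<in>X - set xs. f (take t xs) x \<le> f (take t xs) (xs ! t)" by auto
  have "card (set xs) = n" using xs distinct_card by auto
  then have ne: "X - set xs \<noteq> {}"
    using Suc.prems card_mono[of "set xs" X] by auto
  let ?Y = "f xs ` (X - set xs)"
  have "Max ?Y \<in> ?Y" using ne assms(1) by (intro Max_in) auto
  then obtain y where y: "y \<in> X - set xs" "f xs y = Max ?Y" by auto
  have max: "f xs x \<le> f xs y" if "x \<in> X - set xs" for x
    using that assms(1) by (simp add: y(2))
  show ?case
    by (rule exI[of _ "xs @ [y]"]) (use xs y(1) max in \<open>auto simp: less_Suc_eq nth_append\<close>)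
qed simp

section \<open>Hits and mistakes as sets of rounds\<close>

definition hits :: "'x \<Rightarrow> 'x example list \<Rightarrow> 'x det_learner \<Rightarrow> nat set" where
  "hits x S A = {t \<in> {..<length S}. A (take t S) x}"

definition mistake_rounds :: "'x example list \<Rightarrow> 'x det_learner \<Rightarrow> nat set" where
  "mistake_rounds S A = {t \<in> {..<length S}. A (take t S) (fst (S ! t)) \<noteq> snd (S ! t)}"

text \<open>The prediction in round \<open>a\<close> sees only the examples before it, so agreement
  of the first \<open>a\<close> examples still covers round \<open>a\<close> itself.\<close>

lemma hits_agree:
  assumes "length S = length S'" "take a S = take a S'" "J \<subseteq> {..a}"
  shows "hits x S A \<inter> J = hits x S' A \<inter> J"
proof -
  have "take t S = take t S'" if "t \<le> a" for t
    using assms(2) that by (metis min.absorb1 take_take)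
  then show ?thesis using assms(1,3) by (auto simp: hits_def)
qed

lemma in_example_seqsD:
  assumes "S \<in> example_seqs X T"
  shows "length S = T" "set (take t S) \<subseteq> X \<times> UNIV" "i < T \<Longrightarrow> fst (S ! i) \<in> X"
proof -
  have S: "length S = T" "set S \<subseteq> X \<times> UNIV" using assms by (auto simp: example_seqs_def)
  then show "length S = T" "set (take t S) \<subseteq> X \<times> UNIV" using set_take_subset[of t S] by auto
  show "fst (S ! i) \<in> X" if "i < T"
    using subsetD[OF S(2) nth_mem[of i S]] S(1) that by (simp add: mem_Times_iff)
qed

lemma mistakes_eq_card_mistake_rounds:
  assumes "S \<in> example_seqs X T"
  shows "mistakes X A S = card (mistake_rounds S A)"
proof -
  have "fst (S ! i) \<in> X" if "i < length S" for i
    using in_example_seqsD[OF assms] that by simp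
  then show ?thesis
    unfolding mistakes_def mistake_rounds_def
    by (intro arg_cong[where f = card]) (auto simp: released_def)
qed

section \<open>Events and privacy for a fixed learner\<close>

locale private_online_learner =
  fixes X :: "'x set" and T :: nat and \<epsilon> \<delta> :: real and M :: "'x det_learner measure"
  assumes finite_X: "finite X"
    and learner: "online_learner X M"
    and dp: "differentially_private X T \<epsilon> \<delta> M"
begin

sublocale prob_space M
  using learner by (simp add: online_learner_def)

lemma prediction_event:
  assumes "set H \<subseteq> X \<times> UNIV" "x \<in> X"
  shows "{A \<in> space M. A H x} \<in> events"
  using learner assms by (auto simp: online_learner_def)

lemma hits_event:
  assumes "S \<in> example_seqs X T" "x \<in> X"
  shows "{A \<in> space M. Q (hits x S A)} \<in> events"
  unfolding hits_def
  by (rule sets_Collect_index_set) (auto intro!: prediction_event[OF in_example_seqsD(2)] assms)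

lemma mistake_rounds_event:
  assumes "S \<in> example_seqs X T"
  shows "{A \<in> space M. Q (mistake_rounds S A)} \<in> events"
  unfolding mistake_rounds_def
proof (rule sets_Collect_index_set)
  fix t assume t: "t \<in> {..<length S}"
  have e: "{A \<in> space M. A (take t S) (fst (S ! t))} \<in> events"
    using t in_example_seqsD[OF assms] by (intro prediction_event) auto
  then show "{A \<in> space M. A (take t S) (fst (S ! t)) \<noteq> snd (S ! t)} \<in> events"
    using sets.sets_Collect_neg[OF e] by (cases "snd (S ! t)") auto
qed simp

text \<open>Post-processing: since \<open>x\<close> is in \<open>X\<close>, the hits can be read off
  the released vector. Mistakes also depend on the input sequence, which is why hits are
  compared.\<close>

lemma private_hits:
  assumes "S \<in> example_seqs X T" "S' \<in> example_seqs X T" "differ_in_at_most_one S S'" "x \<in> X"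
  shows "prob {A \<in> space M. Q (hits x S A)} \<le> exp \<epsilon> * prob {A \<in> space M. Q (hits x S' A)} + \<delta>"
proof -
  let ?F = "{r. Q {t \<in> {..<T}. (r ! t) x}}"
  have eq: "(released X A R \<in> ?F) = Q (hits x R A)" if R: "R \<in> example_seqs X T" for A R
  proof -
    have "{t \<in> {..<T}. (released X A R ! t) x} = hits x R A"
      using in_example_seqsD(1)[OF R] assms(4) by (auto simp: hits_def released_def)
    then show ?thesis by simp
  qed
  have "prob {A \<in> space M. released X A S \<in> ?F}
      \<le> exp \<epsilon> * prob {A \<in> space M. released X A S' \<in> ?F} + \<delta>"
    using dp assms(1-3) unfolding differentially_private_def by blast
  then show ?thesis unfolding eq[OF assms(1)] eq[OF assms(2)] .
qed

section \<open>Nested planting of positive examples\<close>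

text \<open>
  The history before \<open>a\<close> starts at \<open>a\<^sub>0\<close>, the position of the outermost planting, so that the
  events in the induction all speak about the first hit after \<open>a\<^sub>0\<close>.
\<close>

lemma plant_positives:
  assumes x: "x \<in> X" and K: "real K \<ge> 2 * exp \<epsilon> + 1" and \<delta>: "\<delta> \<ge> 0"
  shows "S \<in> example_seqs X T \<Longrightarrow> a\<^sub>0 \<le> a \<Longrightarrow> a + K ^ n \<le> T \<Longrightarrow>
    \<exists>S' J. S' \<in> example_seqs X T \<and> J \<subseteq> {a..<T} \<and> card J = n \<and>
      (\<forall>i<T. S' ! i = (if i \<in> J then (x, True) else S ! i)) \<and>
      prob {A \<in> space M. hits x S A \<inter> {a\<^sub>0..<a} = {} \<and> hits x S' A \<inter> J \<noteq> {}}
      \<le> 2 * (exp \<epsilon> * prob {A \<in> space M. hits x S A \<inter> {a\<^sub>0..<a} = {} \<and>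
                 hits x S A \<inter> {a..<a + K ^ n} \<noteq> {}} + n * \<delta>)"
proof (induction n arbitrary: S a)
  case 0
  then show ?case
    by (intro exI[of _ S] exI[of _ "{}"]) auto
next
  case (Suc n)
  note S = Suc.prems(1)
  define L where "L = K ^ n"
  have K2: "K \<ge> 2" using K exp_gt_zero[of \<epsilon>] by linarith
  then have L: "L > 0" by (simp add: L_def)
  have lenS: "length S = T" using S by (rule in_example_seqsD)
  have aT: "a + K * L \<le> T" using Suc.prems(3) by (simp add: L_def)
  have "a < T" using aT K2 L nat_0_less_mult_iff[of K L] by linarith
  define S1 where "S1 = S[a := (x, True)]"
  have S1: "S1 \<in> example_seqs X T"
    using S x set_update_subset_insert[of S a "(x, True)"] by (auto simp: S1_def example_seqs_def)
  have nb: "differ_in_at_most_one S1 S"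
  proof -
    have "{i. i < length S1 \<and> S1 ! i \<noteq> S ! i} \<subseteq> {a}"
    proof safe
      fix i assume "S1 ! i \<noteq> S ! i"
      then show "i = a" by (cases "i = a") (auto simp: S1_def)
    qed
    then have "card {i. i < length S1 \<and> S1 ! i \<noteq> S ! i} \<le> card {a}"
      by (intro card_mono) auto
    then show ?thesis by (simp add: differ_in_at_most_one_def S1_def)
  qed
  have take1: "take a S = take a S1" by (simp add: S1_def)
  have agree1: "hits x S A \<inter> {a\<^sub>0..<a} = hits x S1 A \<inter> {a\<^sub>0..<a}" for A
    by (rule hits_agree[OF _ take1]) (auto simp: S1_def)
  \<comment> \<open>Under \<open>S1\<close>, the first hit from \<open>a\<^sub>0\<close> on falls
    into rounds \<open>l\<close> to \<open>r - 1\<close>. Speaking of the first hit makes these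
    events disjoint for disjoint blocks.\<close>
  define E where "E l r = {A \<in> space M. hits x S1 A \<inter> {a\<^sub>0..<l} = {} \<and> hits x S1 A \<inter> {l..<r} \<noteq> {}}" for l r
  have E_event: "E l r \<in> events" for l r
    unfolding E_def by (rule hits_event[OF S1 x])
  define q where "q = prob {A \<in> space M. hits x S A \<inter> {a\<^sub>0..<a} = {} \<and>
                 hits x S A \<inter> {a..<a + K ^ Suc n} \<noteq> {}}"
  have q1: "prob (E a (a + K * L)) \<le> exp \<epsilon> * q + \<delta>"
    using private_hits[OF S1 S nb x,
      of "\<lambda>J. J \<inter> {a\<^sub>0..<a} = {} \<and> J \<inter> {a..<a + K ^ Suc n} \<noteq> {}"]
    by (simp add: E_def q_def L_def)
  let ?E = "\<lambda>b. E (a + b * L) (a + b * L + L)"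
  have disj: "?E b \<inter> ?E b' = {}" if "b < b'" for b b'
  proof -
    have "b * L + L \<le> b' * L" using that mult_le_mono1[of "Suc b" b' L] by simp
    then have "{a + b * L..<a + b * L + L} \<subseteq> {a\<^sub>0..<a + b' * L}" using Suc.prems(2) by auto
    then show ?thesis unfolding E_def by blast
  qed
  have sub: "?E b \<subseteq> E a (a + K * L)" if "b < K" for b
  proof -
    have "b * L + L \<le> K * L" using that mult_le_mono1[of "Suc b" K L] by simp
    then have "{a + b * L..<a + b * L + L} \<subseteq> {a..<a + K * L}" "{a\<^sub>0..<a} \<subseteq> {a\<^sub>0..<a + b * L}" by auto
    then show ?thesis unfolding E_def by blast
  qed
  txt \<open>Sub-block 0 is excluded because its first round already carries the planted example.\<close>
  have "(\<Sum>b\<in>{1..<K}. prob (?E b)) = prob (\<Union>b\<in>{1..<K}. ?E b)"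
  proof (rule finite_measure_finite_Union[symmetric])
    show "disjoint_family_on ?E {1..<K}"
      unfolding disjoint_family_on_def
      by (intro ballI impI) (metis disj inf_commute linorder_neqE_nat)
  qed (use E_event in auto)
  also have "\<dots> \<le> prob (E a (a + K * L))"
    using sub by (intro finite_measure_mono E_event UN_least) auto
  finally have sumE: "(\<Sum>b\<in>{1..<K}. prob (?E b)) \<le> prob (E a (a + K * L))" .
  obtain b where b: "b \<in> {1..<K}" "prob (?E b) \<le> (\<Sum>b\<in>{1..<K}. prob (?E b)) / card {1..<K}"
    using exists_le_average[of "{1..<K}" "\<lambda>b. prob (?E b)"] K2 by auto
  \<comment> \<open>Averaging over \<open>K - 1\<close>, hence at least
    \<open>2 * exp \<epsilon>\<close>, sub-blocks pays for the factor \<open>exp \<epsilon>\<close>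
    of the next level and halves the probability on top.\<close>
  have bE: "exp \<epsilon> * prob (?E b) \<le> prob (E a (a + K * L)) / 2"
  proof -
    have "real (K - 1) \<ge> 2 * exp \<epsilon>" using K K2 by (simp add: of_nat_diff)
    moreover have "real (K - 1) * prob (?E b) \<le> prob (E a (a + K * L))"
      using b(2) sumE K2 by (simp add: field_simps)
    moreover have "2 * exp \<epsilon> * prob (?E b) \<le> real (K - 1) * prob (?E b)"
      using calculation(1) by (intro mult_right_mono) auto
    ultimately show ?thesis by simp
  qed
  have bL: "b * L + L \<le> K * L" "L \<le> b * L"
    using b(1) mult_le_mono1[of "Suc b" K L] by auto
  have "a\<^sub>0 \<le> a + b * L" "a + b * L + K ^ n \<le> T"
    using Suc.prems(2) aT bL by (auto simp: L_def)
  from Suc.IH[OF S1 this] obtain S' J where S': "S' \<in> example_seqs X T"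
    and J: "J \<subseteq> {a + b * L..<T}" "card J = n"
    and S'_nth: "\<forall>i<T. S' ! i = (if i \<in> J then (x, True) else S1 ! i)"
    and IH: "prob {A \<in> space M. hits x S1 A \<inter> {a\<^sub>0..<a + b * L} = {} \<and> hits x S' A \<inter> J \<noteq> {}}
      \<le> 2 * (exp \<epsilon> * prob (?E b) + n * \<delta>)"
    unfolding E_def L_def by blast
  have finJ: "finite J" using J(1) finite_subset by blast
  have aJ: "a \<notin> J" using J(1) bL(2) L by auto
  have lenS': "length S' = T" and lenS1: "length S1 = T"
    using S' S1 by (auto intro: in_example_seqsD)
  have takeb: "take (a + b * L) S' = take (a + b * L) S1"
    using S'_nth J(1) lenS' lenS1 by (intro nth_equalityI) auto
  have agree2: "hits x S' A \<inter> {..<a + b * L} = hits x S1 A \<inter> {..<a + b * L}" for A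
    by (rule hits_agree[OF _ takeb]) (auto simp: lenS' lenS1)
  let ?J = "insert a J"
  let ?H = "{A \<in> space M. hits x S1 A \<inter> {a\<^sub>0..<a + b * L} = {} \<and> hits x S' A \<inter> J \<noteq> {}}"
  have H_event: "?H \<in> events"
    by (rule sets.sets_Collect_conj[OF hits_event[OF S' x] hits_event[OF S1 x]])
  \<comment> \<open>Either the first hit under \<open>S1\<close> comes before
    \<open>a + b * L\<close>, so inside the current block, or there is no hit before the sub-block.
    In the latter case \<open>a\<close> is not hit under \<open>S'\<close> either, so the hit is in
    \<open>J\<close>.\<close>
  have "{A \<in> space M. hits x S A \<inter> {a\<^sub>0..<a} = {} \<and> hits x S' A \<inter> ?J \<noteq> {}} \<subseteq> E a (a + K * L) \<union> ?H"
  proof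
    fix A assume "A \<in> {A \<in> space M. hits x S A \<inter> {a\<^sub>0..<a} = {} \<and> hits x S' A \<inter> ?J \<noteq> {}}"
    then have A: "A \<in> space M" "hits x S1 A \<inter> {a\<^sub>0..<a} = {}" "hits x S' A \<inter> ?J \<noteq> {}"
      by (auto simp: agree1)
    show "A \<in> E a (a + K * L) \<union> ?H"
    proof (cases "hits x S1 A \<inter> {a..<a + b * L} = {}")
      case False
      moreover have "{a..<a + b * L} \<subseteq> {a..<a + K * L}" using b(1) by auto
      ultimately have "hits x S1 A \<inter> {a..<a + K * L} \<noteq> {}" by blast
      then show ?thesis using A by (auto simp: E_def)
    next
      case True
      moreover have "{a\<^sub>0..<a + b * L} = {a\<^sub>0..<a} \<union> {a..<a + b * L}"
        using Suc.prems(2) by auto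
      ultimately have "hits x S1 A \<inter> {a\<^sub>0..<a + b * L} = {}" using A(2) by blast
      moreover have "a \<notin> hits x S' A"
      proof -
        have ab: "a \<in> {a..<a + b * L}" "a \<in> {..<a + b * L}" using b(1) L by auto
        have "a \<notin> hits x S1 A" using disjoint_iff True ab(1) by metis
        then show ?thesis using agree2[of A] ab(2) by (metis IntD1 IntI)
      qed
      ultimately show ?thesis using A by auto
    qed
  qed
  then have "prob {A \<in> space M. hits x S A \<inter> {a\<^sub>0..<a} = {} \<and> hits x S' A \<inter> ?J \<noteq> {}}
      \<le> prob (E a (a + K * L) \<union> ?H)"
    by (intro finite_measure_mono sets.Un E_event H_event)
  also have "\<dots> \<le> prob (E a (a + K * L)) + prob ?H"
    by (intro measure_Un_le E_event H_event)
  \<comment> \<open>Up to \<open>2 * n * \<delta>\<close>, the deeper levels cost no more than this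
    one. This is the origin of the factor 2.\<close>
  also have "\<dots> \<le> 2 * prob (E a (a + K * L)) + 2 * n * \<delta>"
    using IH bE by (simp add: algebra_simps)
  also have "\<dots> \<le> 2 * (exp \<epsilon> * q + real (Suc n) * \<delta>)"
    using q1 by (simp add: algebra_simps)
  finally have bound: "prob {A \<in> space M. hits x S A \<inter> {a\<^sub>0..<a} = {} \<and> hits x S' A \<inter> ?J \<noteq> {}}
      \<le> 2 * (exp \<epsilon> * q + real (Suc n) * \<delta>)" .
  show ?case
  proof (intro exI conjI)
    show "S' \<in> example_seqs X T" by fact
    show "?J \<subseteq> {a..<T}" using J(1) \<open>a < T\<close> by auto
    show "card ?J = Suc n" using J(2) aJ finJ by simp
    show "\<forall>i<T. S' ! i = (if i \<in> ?J then (x, True) else S ! i)"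
      using S'_nth aJ lenS by (auto simp: S1_def nth_list_update)
  qed (use bound in \<open>simp add: q_def\<close>)
qed

section \<open>The greedy base sequence\<close>

lemma exists_base_sequence:
  assumes "card X = Suc T" and BL: "B > 0" "B * L \<le> T"
  obtains S x a where "S \<in> example_seqs X T" "x \<in> X" "\<And>i. i < T \<Longrightarrow> fst (S ! i) \<noteq> x \<and> \<not> snd (S ! i)"
    "a + L \<le> T"
    "prob {A \<in> space M. hits x S A \<inter> {a..<a + L} \<noteq> {}}
      \<le> prob {A \<in> space M. card (mistake_rounds S A) \<ge> m} + m / B"
proof -
  define neg :: "'x list \<Rightarrow> 'x example list" where "neg = map (\<lambda>x. (x, False))"
  txt \<open>
    Only the first \<open>m\<close> mistakes are counted: the expected number of all mistakes may be large
    even if many mistakes are unlikely.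
  \<close>
  define V where "V R x = prob {A \<in> space M. A R x \<and> card (mistake_rounds R A) < m}" for R x
  obtain xs where xs: "length xs = T" "distinct xs" "set xs \<subseteq> X"
    "\<forall>t<T. \<forall>x\<in>X - set xs. V (neg (take t xs)) x \<le> V (neg (take t xs)) (xs ! t)"
    using exists_greedy_distinct_list[OF finite_X, of T "\<lambda>H. V (neg H)"] assms(1) by auto
  have "card (set xs) = T" using xs distinct_card by auto
  then have "X - set xs \<noteq> {}" using assms(1) finite_X card_mono[of "set xs" X] by auto
  then obtain x where x: "x \<in> X" "x \<notin> set xs" by auto
  define S where "S = neg xs"
  have S: "S \<in> example_seqs X T" using xs by (auto simp: S_def neg_def example_seqs_def)
  have lenS: "length S = T" by (rule in_example_seqsD[OF S])
  have S_nth: "S ! i = (xs ! i, False)" if "i < T" for i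
    using that xs by (simp add: S_def neg_def)
  have prefix: "mistake_rounds (take t S) A = mistake_rounds S A \<inter> {..<t}" if "t < T" for t A
    using that lenS by (auto simp: mistake_rounds_def min_def)
  have V_S: "V (take t S) y = prob {A \<in> space M. A (take t S) y \<and> card (mistake_rounds S A \<inter> {..<t}) < m}"
    if "t < T" for t y
    using that by (simp add: V_def prefix)
  \<comment> \<open>All labels are negative, so a mistake is a prediction of 1 at the query, which
    is what the greedy score measures.\<close>
  have mem: "t \<in> mistake_rounds S A \<longleftrightarrow> A (take t S) (xs ! t)" if "t < T" for t A
    using that by (simp add: mistake_rounds_def lenS S_nth)
  have "(\<Sum>t<T. V (take t S) (xs ! t)) =
      (\<Sum>t<T. prob {A \<in> space M. t \<in> mistake_rounds S A \<and> card (mistake_rounds S A \<inter> {..<t}) < m})"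
    by (intro sum.cong) (auto simp: V_S mem)
  also have "\<dots> \<le> m"
    by (intro sum_prob_first_elements_le mistake_rounds_event[OF S, where Q = "\<lambda>R. _ \<in> R \<and> card (R \<inter> _) < m"])
  finally have "(\<Sum>t<T. V (take t S) (xs ! t)) \<le> m" .
  moreover have "V (take t S) x \<le> V (take t S) (xs ! t)" if "t < T" for t
    using xs(4) that x by (simp add: S_def neg_def take_map)
  then have "(\<Sum>t<T. V (take t S) x) \<le> (\<Sum>t<T. V (take t S) (xs ! t))"
    by (intro sum_mono) auto
  moreover have "(\<Sum>t<B * L. V (take t S) x) \<le> (\<Sum>t<T. V (take t S) x)"
    using BL by (intro sum_mono2) (auto simp: V_def)
  ultimately have total: "(\<Sum>b<B. \<Sum>t\<in>{b * L..<Suc b * L}. V (take t S) x) \<le> m"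
    unfolding sum_lessThan_mult by linarith
  obtain b where b: "b < B"
    "(\<Sum>t\<in>{b * L..<Suc b * L}. V (take t S) x)
      \<le> (\<Sum>b<B. \<Sum>t\<in>{b * L..<Suc b * L}. V (take t S) x) / B"
    using exists_le_average[of "{..<B}" "\<lambda>b. \<Sum>t\<in>{b * L..<Suc b * L}. V (take t S) x"] BL(1)
    by auto
  define a where "a = b * L"
  have aL: "a + L \<le> T"
    using b(1) mult_le_mono1[of "Suc b" B L] BL(2) by (simp add: a_def)
  have "(\<Sum>t\<in>{a..<a + L}. V (take t S) x) \<le> m / B"
    using b(2) divide_right_mono[OF total, of "real B"] by (simp add: a_def add.commute)
  let ?N = "{A \<in> space M. card (mistake_rounds S A) \<ge> m}"
  let ?F = "\<lambda>t. {A \<in> space M. A (take t S) x \<and> card (mistake_rounds S A \<inter> {..<t}) < m}"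
  have N: "?N \<in> events" by (rule mistake_rounds_event[OF S])
  have F: "?F t \<in> events" for t
    by (intro sets.sets_Collect_conj prediction_event x in_example_seqsD(2)[OF S]
        mistake_rounds_event[OF S, where Q = "\<lambda>R. card (R \<inter> _) < m"])
  \<comment> \<open>Outside \<open>?N\<close> there are fewer than \<open>m\<close> mistakes in all,
    so the truncation discards no hit.\<close>
  have "{A \<in> space M. hits x S A \<inter> {a..<a + L} \<noteq> {}} \<subseteq> ?N \<union> (\<Union>t\<in>{a..<a + L}. ?F t)"
  proof
    fix A assume "A \<in> {A \<in> space M. hits x S A \<inter> {a..<a + L} \<noteq> {}}"
    then obtain t where t: "A \<in> space M" "t \<in> {a..<a + L}" "A (take t S) x"
      unfolding hits_def by blast
    have "card (mistake_rounds S A \<inter> {..<t}) \<le> card (mistake_rounds S A)"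
      by (intro card_mono) (auto simp: mistake_rounds_def)
    then show "A \<in> ?N \<union> (\<Union>t\<in>{a..<a + L}. ?F t)"
      using t by (cases "card (mistake_rounds S A) \<ge> m") auto
  qed
  then have "prob {A \<in> space M. hits x S A \<inter> {a..<a + L} \<noteq> {}}
      \<le> prob (?N \<union> (\<Union>t\<in>{a..<a + L}. ?F t))"
    by (intro finite_measure_mono sets.Un N sets.finite_UN F) auto
  also have "\<dots> \<le> prob ?N + prob (\<Union>t\<in>{a..<a + L}. ?F t)"
    by (intro measure_Un_le N sets.finite_UN F) auto
  also have "prob (\<Union>t\<in>{a..<a + L}. ?F t) \<le> (\<Sum>t\<in>{a..<a + L}. prob (?F t))"
    using F by (intro finite_measure_subadditive_finite) auto
  also have "(\<Sum>t\<in>{a..<a + L}. prob (?F t)) = (\<Sum>t\<in>{a..<a + L}. V (take t S) x)"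
    using aL by (intro sum.cong) (auto simp: V_S)
  also note \<open>\<dots> \<le> m / B\<close>
  finally show thesis
    using S x aL xs S_nth nth_mem[of _ xs] by (intro that[of S x a]) auto
qed

section \<open>Many mistakes, and the case of a single mistake\<close>

lemma mistakes_often:
  assumes X: "card X = Suc T" and K: "real K \<ge> 2 * exp \<epsilon> + 1" and pos: "\<epsilon> \<ge> 0" "\<delta> \<ge> 0"
    and k: "k > 0" "4 * K * k * K ^ k \<le> T" "k * \<delta> \<le> 1 / 20"
  shows "\<exists>S\<in>example_seqs X T. (\<exists>h\<in>point_functions X. consistent h S) \<and>
    prob {A \<in> space M. mistakes X A S \<ge> k} \<ge> exp (- \<epsilon>) / 8"
proof -
  have "K > 0" using K exp_gt_zero[of \<epsilon>] by (intro Nat.gr0I) auto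
  then have B: "4 * K * k > 0" using k(1) by simp
  obtain S x a where S: "S \<in> example_seqs X T" "x \<in> X"
    and neg: "\<And>i. i < T \<Longrightarrow> fst (S ! i) \<noteq> x \<and> \<not> snd (S ! i)"
    and a: "a + K ^ k \<le> T"
    and Q: "prob {A \<in> space M. hits x S A \<inter> {a..<a + K ^ k} \<noteq> {}}
      \<le> prob {A \<in> space M. card (mistake_rounds S A) \<ge> k} + k / (4 * K * k)"
    using exists_base_sequence[OF X B k(2), where m = k] by (auto simp only: of_nat_mult of_nat_numeral)
  have c: "consistent (point_function X x) R"
    if "R \<in> example_seqs X T" "\<And>i. i < T \<Longrightarrow> snd (R ! i) = (fst (R ! i) = x)" for R
    using that in_example_seqsD[OF that(1)] by (auto simp: consistent_def point_function_def)
  have h: "point_function X x \<in> point_functions X" using S(2) by (simp add: point_functions_def)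
  show ?thesis
  proof (cases "prob {A \<in> space M. mistakes X A S \<ge> k} \<ge> exp (- \<epsilon>) / 8")
    case True
    then show ?thesis using S(1) c[OF S(1)] neg h by blast
  next
    case False
    \<comment> \<open>\<open>4 * K * k\<close> blocks make this term no larger than the bound
      assumed for \<open>k\<close> mistakes; both together become at most 1/4 after multiplication
      by \<open>exp \<epsilon>\<close>.\<close>
    have "k / (4 * K * k) = 1 / (4 * K)" using k(1) by simp
    also have "\<dots> \<le> exp (- \<epsilon>) / 8"
      using K \<open>K > 0\<close> by (simp add: exp_minus field_simps)
    finally have "prob {A \<in> space M. hits x S A \<inter> {a..<a + K ^ k} \<noteq> {}} \<le> exp (- \<epsilon>) / 4"
      using Q False by (simp add: mistakes_eq_card_mistake_rounds[OF S(1)])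
    then have Q': "exp \<epsilon> * prob {A \<in> space M. hits x S A \<inter> {a..<a + K ^ k} \<noteq> {}} \<le> 1 / 4"
      by (simp add: exp_minus field_simps)
    \<comment> \<open>With \<open>a\<^sub>0 = a\<close> the condition on the history is void, so all
      hits in planted rounds are covered.\<close>
    obtain S' J where S': "S' \<in> example_seqs X T" and J: "J \<subseteq> {a..<T}" "card J = k"
      and S'_nth: "\<forall>i<T. S' ! i = (if i \<in> J then (x, True) else S ! i)"
      and hit: "prob {A \<in> space M. hits x S' A \<inter> J \<noteq> {}}
        \<le> 2 * (exp \<epsilon> * prob {A \<in> space M. hits x S A \<inter> {a..<a + K ^ k} \<noteq> {}} + k * \<delta>)"
      using plant_positives[OF S(2) K pos(2) S(1) le_refl a] by auto
    have lenS': "length S' = T" by (rule in_example_seqsD[OF S'])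
    have ev: "{A \<in> space M. hits x S' A \<inter> J \<noteq> {}} \<in> events"
      by (rule hits_event[OF S' S(2)])
    \<comment> \<open>Planted labels are positive, so a planted round without a hit is a
      mistake.\<close>
    have "{A \<in> space M. \<not> (hits x S' A \<inter> J \<noteq> {})} \<subseteq> {A \<in> space M. mistakes X A S' \<ge> k}"
    proof safe
      fix A assume "hits x S' A \<inter> J = {}"
      then have "J \<subseteq> mistake_rounds S' A"
        using J(1) S'_nth unfolding mistake_rounds_def hits_def lenS' by (auto simp: subset_iff)
      then have "card J \<le> card (mistake_rounds S' A)"
        by (intro card_mono) (auto simp: mistake_rounds_def)
      then show "k \<le> mistakes X A S'"
        by (simp add: J(2) mistakes_eq_card_mistake_rounds[OF S'])
    qed
    then have "prob {A \<in> space M. \<not> (hits x S' A \<inter> J \<noteq> {})} \<le> prob {A \<in> space M. mistakes X A S' \<ge> k}"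
      unfolding mistakes_eq_card_mistake_rounds[OF S']
      by (intro finite_measure_mono mistake_rounds_event[OF S'])
    \<comment> \<open>A planted round is hit with probability at most
      \<open>2 * (1 / 4 + 1 / 20) = 3 / 5\<close>.\<close>
    then have "prob {A \<in> space M. mistakes X A S' \<ge> k} \<ge> 2 / 5"
      using hit Q' k(3) prob_neg[OF ev] by simp
    moreover have "exp (- \<epsilon>) / 8 \<le> 2 / 5" using pos(1) exp_le_one_iff[of "- \<epsilon>"] by linarith
    moreover have "consistent (point_function X x) S'"
      using neg S'_nth by (intro c S') auto
    ultimately show ?thesis using S' h by (intro bexI[of _ S']) auto
  qed
qed

text \<open>The first hypothesis does not depend on the examples, so one of the two labels of
  \<open>x\<close> contradicts it with probability at least 1/2. This serves the \<open>T\<close>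
  that are too small for planting.\<close>

lemma one_mistake_often:
  assumes "T > 0" "card X > 1"
  shows "\<exists>S\<in>example_seqs X T. (\<exists>h\<in>point_functions X. consistent h S) \<and>
    prob {A \<in> space M. mistakes X A S \<ge> 1} \<ge> 1 / 2"
proof -
  obtain x y where xy: "x \<in> X" "y \<in> X" "x \<noteq> y"
    using assms(2) card_le_Suc0_iff_eq[OF finite_X] by (auto simp: not_le[symmetric])
  let ?S = "\<lambda>b. replicate T (x, b)"
  have S: "?S b \<in> example_seqs X T" for b
    using xy by (auto simp: example_seqs_def)
  have ev: "{A \<in> space M. A [] x} \<in> events"
    by (rule prediction_event) (use xy in auto)
  have ge: "prob {A \<in> space M. A [] x \<noteq> b} \<le> prob {A \<in> space M. mistakes X A (?S b) \<ge> 1}" for b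
    unfolding mistakes_eq_card_mistake_rounds[OF S]
  proof (intro finite_measure_mono mistake_rounds_event[OF S] subsetI)
    fix A assume A: "A \<in> {A \<in> space M. A [] x \<noteq> b}"
    then have "0 \<in> mistake_rounds (?S b) A" using assms(1) by (auto simp: mistake_rounds_def)
    moreover have "finite (mistake_rounds (?S b) A)" by (simp add: mistake_rounds_def)
    ultimately show "A \<in> {A \<in> space M. card (mistake_rounds (?S b) A) \<ge> 1}"
      using A by (auto simp: Suc_le_eq card_gt_0_iff)
  qed
  have "prob {A \<in> space M. A [] x \<noteq> True} + prob {A \<in> space M. A [] x \<noteq> False} = 1"
    using prob_neg[OF ev] by simp
  then have "prob {A \<in> space M. A [] x \<noteq> True} \<ge> 1 / 2 \<or> prob {A \<in> space M. A [] x \<noteq> False} \<ge> 1 / 2"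
    by linarith
  then obtain b where "prob {A \<in> space M. A [] x \<noteq> b} \<ge> 1 / 2" by blast
  \<comment> \<open>The all-negative sequence is realised by the point function of a second
    point.\<close>
  moreover have "consistent (point_function X (if b then x else y)) (?S b)"
    using xy by (auto simp: consistent_def point_function_def)
  moreover have "point_function X (if b then x else y) \<in> point_functions X"
    using xy by (auto simp: point_functions_def)
  ultimately show ?thesis using ge[of b] S[of b] by (meson order_trans)
qed

end

section \<open>Choice of the constants\<close>

text \<open>The base sequence must hold \<open>4 * K * k\<close> blocks of length
  \<open>K ^ k\<close>. Crude bounds put this below \<open>K ^ (5 * k)\<close>, so \<open>k\<close>
  can be a constant fraction of \<open>log K T\<close>.\<close>

lemma planting_fits:
  fixes K k T :: nat
  assumes "K \<ge> 3" "k > 0" "K ^ (5 * k) \<le> T"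
  shows "4 * K * k * K ^ k \<le> T"
proof -
  have "4 \<le> K ^ 2" using assms(1) power_mono[of 3 K 2] by simp
  moreover have "k \<le> K ^ k" using assms(1) by (intro less_imp_le power_gt_expt) auto
  ultimately have "4 * K * k * K ^ k \<le> K ^ 2 * K * K ^ k * K ^ k"
    by (intro mult_le_mono) auto
  also have "\<dots> = K ^ (3 + 2 * k)"
    by (simp add: power_add mult_2 power3_eq_cube power2_eq_square ac_simps flip: power2_eq_square power_mult)
  also have "\<dots> \<le> K ^ (5 * k)" using assms(1,2) by (intro power_increasing) auto
  finally show ?thesis using assms(3) by simp
qed

theorem theorem11:
  fixes \<epsilon> :: real
  assumes "\<epsilon> > 0"
  shows "\<exists>c p :: real. c > 0 \<and> p > 0 \<and>
    (\<forall>(T::nat) (X :: nat set) (\<delta>::real) (M :: nat det_learner measure).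
       T \<ge> 100 \<longrightarrow> X = {0..T} \<longrightarrow> \<delta> = 1 / (20 * log 2 (real T)) \<longrightarrow>
       online_learner X M \<longrightarrow> differentially_private X T \<epsilon> \<delta> M \<longrightarrow>
       (\<exists>S\<in>example_seqs X T.
          (\<exists>h\<in>point_functions X. consistent h S) \<and>
          measure M {A \<in> space M. real (mistakes X A S) \<ge> c * log 2 (real T)} \<ge> p))"
proof -
  define K where "K = nat \<lceil>2 * exp \<epsilon> + 1\<rceil>"
  have K: "real K \<ge> 2 * exp \<epsilon> + 1" unfolding K_def by linarith
  then have K3: "K \<ge> 3" using assms exp_gt_one[of \<epsilon>] by linarith
  have "log 2 K > 0" using K3 by simp
  \<comment> \<open>Then \<open>c * log 2 T = log K T / 10\<close>, half of the value that
    \<open>k\<close> rounds down.\<close>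
  define c where "c = 1 / (10 * log 2 K)"
  have c: "c > 0" using \<open>log 2 K > 0\<close> by (simp add: c_def)
  show ?thesis
  proof (rule exI[of _ c], rule exI[of _ "exp (- \<epsilon>) / 8"], intro conjI allI impI c)
    fix T :: nat and X :: "nat set" and \<delta> :: real and M :: "nat det_learner measure"
    assume T: "T \<ge> 100" and X: "X = {0..T}" and \<delta>: "\<delta> = 1 / (20 * log 2 (real T))"
      and M: "online_learner X M" "differentially_private X T \<epsilon> \<delta> M"
    interpret private_online_learner X T \<epsilon> \<delta> M
      using X M by unfold_locales auto
    have logT: "log 2 T > 0" using T by simp
    have cardX: "card X = Suc T" using X by simp
    have log_KT: "log K T = 10 * (c * log 2 T)"
      using K3 by (simp add: c_def log_base_change[of 2 K T])
    define k where "k = nat \<lfloor>log K T / 5\<rfloor>"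
    have logKT: "log K T > 0" using log_KT c logT by simp
    have suff: "\<exists>S\<in>example_seqs X T. (\<exists>h\<in>point_functions X. consistent h S) \<and>
          exp (- \<epsilon>) / 8 \<le> prob {A \<in> space M. c * log 2 (real T) \<le> real (mistakes X A S)}"
      if n: "real n \<ge> c * log 2 T"
        and ex: "\<exists>S\<in>example_seqs X T. (\<exists>h\<in>point_functions X. consistent h S) \<and>
          prob {A \<in> space M. mistakes X A S \<ge> n} \<ge> exp (- \<epsilon>) / 8" for n
    proof -
      from ex obtain S where S: "S \<in> example_seqs X T" "\<exists>h\<in>point_functions X. consistent h S"
        and p: "prob {A \<in> space M. mistakes X A S \<ge> n} \<ge> exp (- \<epsilon>) / 8" by blast
      have "prob {A \<in> space M. mistakes X A S \<ge> n}
          \<le> prob {A \<in> space M. c * log 2 (real T) \<le> real (mistakes X A S)}"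
        unfolding mistakes_eq_card_mistake_rounds[OF S(1)]
        using n by (intro finite_measure_mono mistake_rounds_event[OF S(1)]) auto
      then show ?thesis using S p by (intro bexI[of _ S]) auto
    qed
    show "\<exists>S\<in>example_seqs X T.
          (\<exists>h\<in>point_functions X. consistent h S) \<and>
          exp (- \<epsilon>) / 8 \<le> measure M {A \<in> space M. c * log 2 (real T) \<le> real (mistakes X A S)}"
    proof (cases "k = 0")
      case True
      then have "log K T < 5" by (simp add: k_def)
      \<comment> \<open>Here \<open>c * log 2 T < 1 / 2\<close>, so a single mistake is
        enough.\<close>
      then have "real 1 \<ge> c * log 2 T" using log_KT by simp
      moreover have p: "exp (- \<epsilon>) / 8 \<le> 1 / 2"
        using assms exp_le_one_iff[of "- \<epsilon>"] by linarith
      have "\<exists>S\<in>example_seqs X T. (\<exists>h\<in>point_functions X. consistent h S) \<and>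
          prob {A \<in> space M. mistakes X A S \<ge> 1} \<ge> exp (- \<epsilon>) / 8"
        using one_mistake_often T cardX order_trans[OF p] by fastforce
      ultimately show ?thesis by (rule suff)
    next
      case False
      then have k: "real k \<le> log K T / 5" "real k > log K T / 5 - 1"
        unfolding k_def using logKT by linarith+
      have "real (5 * k) \<le> log K T" using k(1) by simp
      then have "real K powr real (5 * k) \<le> T"
        using K3 T by (subst (asm) le_log_iff) auto
      then have "real (K ^ (5 * k)) \<le> real T" using K3 by (simp add: powr_realpow del: of_nat_mult)
      then have KT: "K ^ (5 * k) \<le> T" by linarith
      \<comment> \<open>\<open>k \<le> log 2 T\<close> keeps the accumulated
        \<open>k * \<delta>\<close> at most 1/20.\<close>
      have "2 ^ k \<le> K ^ k" using K3 by (intro power_mono) auto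
      also have "\<dots> \<le> K ^ (5 * k)" using K3 by (intro power_increasing) auto
      finally have "real k \<le> log 2 T" using KT T by (intro le_log2_of_power) auto
      then have "k * \<delta> \<le> 1 / 20" using logT by (simp add: \<delta> field_simps)
      moreover have "\<delta> \<ge> 0" using logT by (simp add: \<delta>)
      ultimately have "\<exists>S\<in>example_seqs X T. (\<exists>h\<in>point_functions X. consistent h S) \<and>
          prob {A \<in> space M. mistakes X A S \<ge> k} \<ge> exp (- \<epsilon>) / 8"
        using False K3 KT assms by (intro mistakes_often[OF cardX K] planting_fits) auto
      \<comment> \<open>As \<open>k \<ge> 1\<close>,
        \<open>2 * k \<ge> k + 1 > log K T / 5\<close>.\<close>
      moreover have "real k \<ge> c * log 2 T" using k(2) log_KT False by linarith
      ultimately show ?thesis by (intro suff[of k])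
    qed
  qed simp
qed

end
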